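(* Let $I\subseteq[0,\infty)$ be an interval with interior $I^{\circ}$, let $f:I\to\mathbb{R}$ be differentiable on $I^{\circ}$, let $a,b\in I^{\circ}$ with $a<b$, and suppose $f'\in L[a,b]$. Let $g:[a,b]\to\mathbb{R}$ be continuous and let $\alpha>0$. If $|f'|$ is $s$-convex in the second sense on $[a,b]$ for some fixed $s\in(0,1]$, then $$\left| f\left(\tfrac{a+b}{2}\right)\left[J_{\left(\frac{a+b}{2}\right)-}^{\alpha}g(a)+J_{\left(\frac{a+b}{2}\right)+}^{\alpha}g(b)\right]-\left[J_{\left(\frac{a+b}{2}\right)-}^{\alpha}(fg)(a)+J_{\left(\frac{a+b}{2}\right)+}^{\alpha}(fg)(b)\right]\right|$$ $$\le \frac{(b-a)^{\alpha+1}\|g\|_{[a,b],\infty}}{\Gamma(\alpha+1)}\left\{B_{1/2}(\alpha+1,s+1)+\frac{1}{2^{\alpha+s+1}(\alpha+s+1)}\right\}\left[|f'(a)|+|f'(b)|\right].$$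
   Context: A function $h$ is $s$-convex in the second sense on $[a,b]$ (where $[a,b]\subset[0,\infty)$, $s\in(0,1]$) if $h(\lambda x+(1-\lambda)y)\le\lambda^{s}h(x)+(1-\lambda)^{s}h(y)$ for all $x,y\in[a,b]$ and $\lambda\in[0,1]$. Riemann–Liouville fractional integrals of order $\alpha>0$: for a base point $c$, $J_{c+}^{\alpha}h(x)=\frac{1}{\Gamma(\alpha)}\int_{c}^{x}(x-t)^{\alpha-1}h(t)\,dt$ for $x>c$, and $J_{c-}^{\alpha}h(x)=\frac{1}{\Gamma(\alpha)}\int_{x}^{c}(t-x)^{\alpha-1}h(t)\,dt$ for $x<c$. Here $\Gamma$ is the Gamma function, and $fg$ denotes the pointwise product. Incomplete Beta function: $B_{x}(\mu,\nu)=\int_{0}^{x}t^{\mu-1}(1-t)^{\nu-1}\,dt$. $\|g\|_{[a,b],\infty}=\sup_{t\in[a,b]}|g(t)|$, and $L[a,b]$ is the space of Lebesgue integrable functions on $[a,b]$. *)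

theory Defs
  imports "HOL-Analysis.Analysis"
begin

definition s_convex_on :: "real \<Rightarrow> real set \<Rightarrow> (real \<Rightarrow> real) \<Rightarrow> bool" where
  "s_convex_on s A h \<longleftrightarrow> 0 < s \<and> s \<le> 1 \<and> A \<subseteq> {0..} \<and>
     (\<forall>x\<in>A. \<forall>y\<in>A. \<forall>l\<in>{0..1}.
        h (l * x + (1 - l) * y) \<le> l powr s * h x + (1 - l) powr s * h y)"

text \<open>Riemann-Liouville fractional integrals of order \<open>\<alpha>\<close> with base point \<open>c\<close>, evaluated at \<open>x\<close>.
  They are meaningful for \<open>c < x\<close> (right) and \<open>x < c\<close> (left) only. At \<open>t = x\<close> the
  kernel takes the value \<open>0 powr (\<alpha> - 1) = 0\<close>, which does not affect the integral.\<close>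

definition RL_right :: "real \<Rightarrow> real \<Rightarrow> (real \<Rightarrow> real) \<Rightarrow> real \<Rightarrow> real" where
  "RL_right \<alpha> c h x =
     1 / Gamma \<alpha> * (LINT t:{c..x}|lebesgue. (x - t) powr (\<alpha> - 1) * h t)"

definition RL_left :: "real \<Rightarrow> real \<Rightarrow> (real \<Rightarrow> real) \<Rightarrow> real \<Rightarrow> real" where
  "RL_left \<alpha> c h x =
     1 / Gamma \<alpha> * (LINT t:{x..c}|lebesgue. (t - x) powr (\<alpha> - 1) * h t)"

definition incomplete_Beta :: "real \<Rightarrow> real \<Rightarrow> real \<Rightarrow> real" where
  "incomplete_Beta x \<mu> \<nu> =
     (LINT t:{0..x}|lebesgue. t powr (\<mu> - 1) * (1 - t) powr (\<nu> - 1))"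

definition sup_norm_on :: "real set \<Rightarrow> (real \<Rightarrow> real) \<Rightarrow> real" where
  "sup_norm_on A g = (SUP t\<in>A. \<bar>g t\<bar>)"

end

theory Submission
  imports Defs
begin

text \<open>Both fractional integrals rescale to weights \<open>u powr (\<alpha> - 1)\<close> on \<open>{0..1/2}\<close>, with
  \<open>u\<close> the relative distance to the endpoint \<open>a\<close> or \<open>b\<close>; this reduces the two halves to one estimate.
  By \<open>s\<close>-convexity the derivative of the rescaled function \<open>F\<close> is dominated by a continuous
  \<open>\<Phi>\<close>, so \<open>\<bar>F (1/2) - F u\<bar>\<close> is at most the integral \<open>P u\<close> of \<open>\<Phi>\<close> over \<open>{u..1/2}\<close>.
  Integrating \<open>u powr (\<alpha> - 1) * P u\<close> by parts, where both boundary terms vanish, leaves the integral of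
  \<open>u powr \<alpha> * \<Phi> u / \<alpha>\<close>, which is the incomplete Beta expression.\<close>

lemma powr_kernel_absolutely_integrable:
  fixes \<alpha> r :: real and h :: "real \<Rightarrow> real"
  assumes "\<alpha> > 0" and "r \<ge> 0" and "continuous_on {0..r} h"
  shows "(\<lambda>u. u powr (\<alpha> - 1) * h u) absolutely_integrable_on {0..r}"
proof -
  have "(\<lambda>u. u powr (\<alpha> - 1)) integrable_on {0..r}"
    using has_integral_powr_from_0[of "\<alpha> - 1" r] assms by (auto simp: integrable_on_def)
  then have "(\<lambda>u. u powr (\<alpha> - 1)) absolutely_integrable_on {0..r}"
    by (intro nonnegative_absolutely_integrable_1) auto
  moreover have "h \<in> borel_measurable (lebesgue_on {0..r})"
    using assms by (intro continuous_imp_measurable_on_sets_lebesgue) auto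
  moreover have "bounded (h ` {0..r})"
    using assms by (intro compact_imp_bounded compact_continuous_image) auto
  ultimately have "(\<lambda>u. h u * u powr (\<alpha> - 1)) absolutely_integrable_on {0..r}"
    by (intro absolutely_integrable_bounded_measurable_product_real) auto
  then show ?thesis by (simp add: mult.commute)
qed

text \<open>\<open>F'\<close> is controlled only pointwise, so \<open>F\<close> is compared with an
  antiderivative \<open>Q\<close> of the majorant \<Phi> by a mean value inequality instead of
  integrating \<open>F'\<close>. Integration by parts then moves the kernel from \<open>P\<close> to
  \<Phi>, which raises its exponent by one and produces the factor
  \<open>1 / \<alpha>\<close>.\<close>

lemma powr_kernel_weighted_bound:
  fixes F F' \<Phi> G :: "real \<Rightarrow> real" and \<alpha> r M :: real
  assumes \<alpha>: "\<alpha> > 0" and r: "r > 0"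
    and F: "continuous_on {0..r} F"
    and F': "\<And>x. x \<in> {0<..<r} \<Longrightarrow> (F has_real_derivative F' x) (at x)"
    and \<Phi>: "continuous_on {0..r} \<Phi>"
    and F'_le: "\<And>x. x \<in> {0<..<r} \<Longrightarrow> \<bar>F' x\<bar> \<le> \<Phi> x"
    and G: "continuous_on {0..r} G"
    and G_le: "\<And>x. x \<in> {0..r} \<Longrightarrow> \<bar>G x\<bar> \<le> M"
  shows "\<bar>F r * integral {0..r} (\<lambda>u. u powr (\<alpha> - 1) * G u)
            - integral {0..r} (\<lambda>u. u powr (\<alpha> - 1) * (F u * G u))\<bar>
         \<le> M / \<alpha> * integral {0..r} (\<lambda>u. u powr \<alpha> * \<Phi> u)"
proof -
  define Q where "Q = (\<lambda>t. integral {0..t} \<Phi>)"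
  define P where "P = (\<lambda>t. Q r - Q t)"
  have Q': "(Q has_real_derivative \<Phi> t) (at t)" if "t \<in> {0<..<r}" for t
  proof -
    have "(Q has_real_derivative \<Phi> t) (at t within {0..r})"
      unfolding Q_def using integral_has_real_derivative[OF \<Phi>, of t] that by auto
    then show ?thesis
      using that by (simp add: at_within_Icc_at)
  qed
  have Q_cont: "continuous_on {0..r} Q"
    unfolding Q_def using indefinite_integral_continuous_1[OF integrable_continuous_real[OF \<Phi>]] .
  then have P_cont: "continuous_on {0..r} P"
    unfolding P_def by (intro continuous_intros)
  have dev: "\<bar>F r - F t\<bar> \<le> P t" if t: "t \<in> {0..r}" for t
  \<comment> \<open>The mean value inequality is applied on \<open>{t..r}\<close> and asks for
    \<open>t < r\<close>; at \<open>t = r\<close> both sides are zero.\<close>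
  proof (cases "t = r")
    case True
    then show ?thesis by (simp add: P_def)
  next
    case False
    have "norm (F r - F t) \<le> Q r - Q t"
    proof (rule differentiable_bound_general[where f' = F' and \<phi>' = \<Phi>])
      show "t < r" using False t by auto
      show "continuous_on {t..r} F" "continuous_on {t..r} Q"
        using t by (auto intro: continuous_on_subset[OF F] continuous_on_subset[OF Q_cont])
      show "(F has_vector_derivative F' x) (at x)" "(Q has_vector_derivative \<Phi> x) (at x)"
        "norm (F' x) \<le> \<Phi> x" if "t < x" "x < r" for x
        using F'[of x] Q'[of x] F'_le[of x] that t
        by (auto simp: has_real_derivative_iff_has_vector_derivative)
    qed
    then show ?thesis by (simp add: P_def)
  qed
  have kP: "(\<lambda>u. u powr (\<alpha> - 1) * P u) integrable_on {0..r}"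
    using powr_kernel_absolutely_integrable[OF \<alpha> _ P_cont] r by (simp add: absolutely_integrable_on_def)
  have powr_cont: "continuous_on {0..r} (\<lambda>u. u powr \<alpha>)"
    using \<alpha> by (intro continuous_on_powr' continuous_intros) auto
  have k\<Phi>: "(\<lambda>u. u powr \<alpha> * \<Phi> u / \<alpha>) integrable_on {0..r}"
    using \<alpha> by (intro integrable_continuous_real continuous_intros powr_cont \<Phi>) auto
  \<comment> \<open>The integrand is the derivative of
    \<open>u powr \<alpha> / \<alpha> * P u\<close>, as \<open>P\<close> has derivative -\<Phi>. The
    interior form of the fundamental theorem is used because \<open>u powr \<alpha>\<close> may fail
    to be differentiable at 0. The boundary terms vanish since \<open>P r = 0\<close> and
    \<open>0 powr \<alpha> = 0\<close>.\<close>
  have "((\<lambda>u. u powr (\<alpha> - 1) * P u - u powr \<alpha> * \<Phi> u / \<alpha>) has_integral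
          (r powr \<alpha> / \<alpha> * P r - 0 powr \<alpha> / \<alpha> * P 0)) {0..r}"
  proof (rule fundamental_theorem_of_calculus_interior)
    show "continuous_on {0..r} (\<lambda>u. u powr \<alpha> / \<alpha> * P u)"
      using \<alpha> by (intro continuous_intros powr_cont P_cont) auto
    show "((\<lambda>u. u powr \<alpha> / \<alpha> * P u) has_vector_derivative
            (x powr (\<alpha> - 1) * P x - x powr \<alpha> * \<Phi> x / \<alpha>)) (at x)" if x: "x \<in> {0<..<r}" for x
      unfolding has_real_derivative_iff_has_vector_derivative[symmetric] P_def
      using x \<alpha> by (auto intro!: derivative_eq_intros Q' simp: field_simps)
  qed (use r in simp)
  then have parts: "integral {0..r} (\<lambda>u. u powr (\<alpha> - 1) * P u)
      = integral {0..r} (\<lambda>u. u powr \<alpha> * \<Phi> u / \<alpha>)"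
    using integral_diff[OF kP k\<Phi>] \<alpha> by (simp add: integral_unique P_def)
  have kG: "(\<lambda>u. u powr (\<alpha> - 1) * G u) integrable_on {0..r}"
    using powr_kernel_absolutely_integrable[OF \<alpha> _ G] r by (simp add: absolutely_integrable_on_def)
  have kFG: "(\<lambda>u. u powr (\<alpha> - 1) * (F u * G u)) integrable_on {0..r}"
    using powr_kernel_absolutely_integrable[OF \<alpha> _ continuous_on_mult[OF F G]] r
    by (simp add: absolutely_integrable_on_def)
  have "norm (integral {0..r} (\<lambda>u. F r * (u powr (\<alpha> - 1) * G u) - u powr (\<alpha> - 1) * (F u * G u)))
      \<le> integral {0..r} (\<lambda>u. M * (u powr (\<alpha> - 1) * P u))"
  proof (rule integral_norm_bound_integral)
    show "(\<lambda>u. F r * (u powr (\<alpha> - 1) * G u) - u powr (\<alpha> - 1) * (F u * G u)) integrable_on {0..r}"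
      using kG kFG by (intro integrable_diff integrable_on_mult_right)
    show "(\<lambda>u. M * (u powr (\<alpha> - 1) * P u)) integrable_on {0..r}"
      using kP by (rule integrable_on_mult_right)
    fix u assume u: "u \<in> {0..r}"
    have "\<bar>F r - F u\<bar> * \<bar>G u\<bar> \<le> P u * M"
      using dev[OF u] G_le[OF u] by (intro mult_mono) auto
    then have "u powr (\<alpha> - 1) * (\<bar>F r - F u\<bar> * \<bar>G u\<bar>) \<le> u powr (\<alpha> - 1) * (P u * M)"
      by (rule mult_left_mono) simp
    moreover have "F r * (u powr (\<alpha> - 1) * G u) - u powr (\<alpha> - 1) * (F u * G u)
        = u powr (\<alpha> - 1) * ((F r - F u) * G u)"
      by (simp add: algebra_simps)
    ultimately show "norm (F r * (u powr (\<alpha> - 1) * G u) - u powr (\<alpha> - 1) * (F u * G u))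
        \<le> M * (u powr (\<alpha> - 1) * P u)"
      by (simp add: abs_mult mult_ac)
  qed
  moreover have "integral {0..r} (\<lambda>u. F r * (u powr (\<alpha> - 1) * G u) - u powr (\<alpha> - 1) * (F u * G u))
      = F r * integral {0..r} (\<lambda>u. u powr (\<alpha> - 1) * G u)
        - integral {0..r} (\<lambda>u. u powr (\<alpha> - 1) * (F u * G u))"
    using kG kFG by (subst integral_diff) (auto intro: integrable_on_mult_right)
  ultimately show ?thesis
    by (simp add: parts)
qed

text \<open>The bracket is the shape that s-convexity gives to the majorant. Its first term yields
  an incomplete Beta integrand with both parameters shifted by one, its second a pure power of
  \<open>u\<close>.\<close>

lemma integral_powr_s_convex_majorant:
  fixes \<alpha> s r A B :: real
  assumes "\<alpha> > 0" and "s > 0" and "0 \<le> r" and "r \<le> 1"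
  shows "integral {0..r} (\<lambda>u. u powr \<alpha> * (A * (1 - u) powr s + B * u powr s))
       = A * incomplete_Beta r (\<alpha> + 1) (s + 1) + B * (r powr (\<alpha> + s + 1) / (\<alpha> + s + 1))"
proof -
  have cont: "continuous_on {0..r} (\<lambda>u. u powr \<alpha> * (1 - u) powr s)"
    using assms by (intro continuous_intros continuous_on_powr') auto
  have "incomplete_Beta r (\<alpha> + 1) (s + 1) = integral {0..r} (\<lambda>u. u powr \<alpha> * (1 - u) powr s)"
    using set_lebesgue_integral_eq_integral(2)[OF absolutely_integrable_continuous_real[OF cont]]
    by (simp add: incomplete_Beta_def)
  then have "((\<lambda>u. u powr \<alpha> * (1 - u) powr s) has_integral incomplete_Beta r (\<alpha> + 1) (s + 1)) {0..r}"
    using integrable_continuous_real[OF cont] by (simp add: has_integral_integral)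
  moreover have "((\<lambda>u. u powr (\<alpha> + s)) has_integral r powr (\<alpha> + s + 1) / (\<alpha> + s + 1)) {0..r}"
    using has_integral_powr_from_0[of "\<alpha> + s" r] assms by simp
  ultimately have "((\<lambda>u. A * (u powr \<alpha> * (1 - u) powr s) + B * u powr (\<alpha> + s)) has_integral
      A * incomplete_Beta r (\<alpha> + 1) (s + 1) + B * (r powr (\<alpha> + s + 1) / (\<alpha> + s + 1))) {0..r}"
    by (intro has_integral_add has_integral_mult_right)
  moreover have "(\<lambda>u. A * (u powr \<alpha> * (1 - u) powr s) + B * u powr (\<alpha> + s))
      = (\<lambda>u. u powr \<alpha> * (A * (1 - u) powr s + B * u powr s))"
    by (simp add: powr_add algebra_simps)
  ultimately show ?thesis by (simp add: integral_unique)
qed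

text \<open>Under \<open>t = a + d * u\<close> the kernel contributes
  \<open>d powr (\<alpha> - 1)\<close> and the Jacobian one more factor \<open>d\<close>. With
  \<open>d\<close> the full length of the interval, the midpoint corresponds to
  \<open>r = 1 / 2\<close>, and \<open>u\<close> and \<open>1 - u\<close> become the convexity
  coefficients.\<close>

lemma RL_left_eq_integral:
  fixes \<alpha> a d r :: real and h :: "real \<Rightarrow> real"
  assumes \<alpha>: "\<alpha> > 0" and d: "d > 0" and r: "r \<ge> 0"
    and h: "continuous_on {0..r} (\<lambda>u. h (a + d * u))"
  shows "RL_left \<alpha> (a + d * r) h a
       = d powr \<alpha> / Gamma \<alpha> * integral {0..r} (\<lambda>u. u powr (\<alpha> - 1) * h (a + d * u))"
proof -
  \<comment> \<open>Keeping the indicator inside the integrand lets the affine substitution act on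
    the whole line; off \<open>{0..r}\<close> both sides are zero because
    \<open>d > 0\<close>.\<close>
  have ind: "indicator {a..a + d * r} (a + d * u) *\<^sub>R ((a + d * u - a) powr (\<alpha> - 1) * h (a + d * u))
      = d powr (\<alpha> - 1) * (indicator {0..r} u *\<^sub>R (u powr (\<alpha> - 1) * h (a + d * u)))" for u
    using d by (auto simp: indicator_def powr_mult zero_le_mult_iff)
  have "(LINT t:{a..a + d * r}|lebesgue. (t - a) powr (\<alpha> - 1) * h t)
      = d * (d powr (\<alpha> - 1) * (LINT u:{0..r}|lebesgue. u powr (\<alpha> - 1) * h (a + d * u)))"
    unfolding set_lebesgue_integral_def
    by (subst lebesgue_integral_real_affine[where c = d and t = a]) (use d in \<open>simp_all only: ind, simp_all\<close>)
  also have "(LINT u:{0..r}|lebesgue. u powr (\<alpha> - 1) * h (a + d * u))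
      = integral {0..r} (\<lambda>u. u powr (\<alpha> - 1) * h (a + d * u))"
    by (rule set_lebesgue_integral_eq_integral(2)[OF powr_kernel_absolutely_integrable[OF \<alpha> r h]])
  also have "d * (d powr (\<alpha> - 1) * x) = d powr \<alpha> * x" for x
    using d by (simp add: powr_diff)
  finally show ?thesis by (simp add: RL_left_def)
qed

text \<open>The reflection \<open>t \<mapsto> - t\<close> exchanges the two sides, so the rescaling
  of the right integral follows from that of the left one.\<close>

lemma RL_right_eq_RL_left: "RL_right \<alpha> c h x = RL_left \<alpha> (- c) (\<lambda>t. h (- t)) (- x)"
proof -
  have "indicator {c..x} (- t) = (indicator {- x..- c} t :: real)" for t
    by (auto simp: indicator_def)
  then have "(LINT t:{c..x}|lebesgue. (x - t) powr (\<alpha> - 1) * h t)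
      = (LINT t:{- x..- c}|lebesgue. (t - - x) powr (\<alpha> - 1) * h (- t))"
    unfolding set_lebesgue_integral_def
    by (subst lebesgue_integral_real_affine[where c = "-1" and t = 0]) (simp_all add: add.commute)
  then show ?thesis by (simp add: RL_right_def RL_left_def)
qed

lemma RL_right_eq_integral:
  fixes \<alpha> b d r :: real and h :: "real \<Rightarrow> real"
  assumes "\<alpha> > 0" and "d > 0" and "r \<ge> 0" and "continuous_on {0..r} (\<lambda>u. h (b - d * u))"
  shows "RL_right \<alpha> (b - d * r) h b
       = d powr \<alpha> / Gamma \<alpha> * integral {0..r} (\<lambda>u. u powr (\<alpha> - 1) * h (b - d * u))"
  using RL_left_eq_integral[of \<alpha> d r "\<lambda>t. h (- t)" "- b"] assms
  by (simp add: RL_right_eq_RL_left)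

theorem theorem7:
  fixes I :: "real set" and f g :: "real \<Rightarrow> real" and a b \<alpha> s :: real
  assumes "is_interval I" and "I \<subseteq> {0..}"
    and "\<And>x. x \<in> interior I \<Longrightarrow> f differentiable (at x)"
    and "a \<in> interior I" and "b \<in> interior I" and "a < b"
    and "deriv f absolutely_integrable_on {a..b}"
    and "continuous_on {a..b} g"
    and "\<alpha> > 0"
    and "0 < s" and "s \<le> 1"
    and "s_convex_on s {a..b} (\<lambda>x. \<bar>deriv f x\<bar>)"
  shows "\<bar>f ((a + b) / 2) * (RL_left \<alpha> ((a + b) / 2) g a + RL_right \<alpha> ((a + b) / 2) g b)
          - (RL_left \<alpha> ((a + b) / 2) (\<lambda>t. f t * g t) a
             + RL_right \<alpha> ((a + b) / 2) (\<lambda>t. f t * g t) b)\<bar>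
         \<le> (b - a) powr (\<alpha> + 1) * sup_norm_on {a..b} g / Gamma (\<alpha> + 1)
           * (incomplete_Beta (1 / 2) (\<alpha> + 1) (s + 1)
              + 1 / (2 powr (\<alpha> + s + 1) * (\<alpha> + s + 1)))
           * (\<bar>deriv f a\<bar> + \<bar>deriv f b\<bar>)"
proof -
  note fdiff = assms(3) and ab = \<open>a < b\<close> and \<alpha> = \<open>\<alpha> > 0\<close> and s = \<open>0 < s\<close>
  define d where "d = b - a"
  define M where "M = sup_norm_on {a..b} g"
  define A where "A = \<bar>deriv f a\<bar>"
  define B where "B = \<bar>deriv f b\<bar>"
  define G where "G = Gamma \<alpha>"
  define c where "c = d powr \<alpha> / G"
  define \<beta> where "\<beta> = incomplete_Beta (1 / 2) (\<alpha> + 1) (s + 1)"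
  define \<gamma> where "\<gamma> = (1 / 2) powr (\<alpha> + s + 1) / (\<alpha> + s + 1)"
  have d: "d > 0" using ab by (simp add: d_def)
  have G: "G > 0" unfolding G_def using \<alpha> by (rule Gamma_real_pos)
  have c: "c \<ge> 0" using G by (simp add: c_def G_def)
  have "is_interval (interior I)"
    using assms(1) by (simp add: is_interval_convex_1 convex_interior)
  then have sub: "{a..b} \<subseteq> interior I"
    using assms(4,5) unfolding is_interval_1 by (meson atLeastAtMost_iff subsetI)
  then have f': "(f has_real_derivative deriv f x) (at x)" if "x \<in> {a..b}" for x
    using fdiff that by (auto simp: DERIV_deriv_iff_real_differentiable)
  then have f_cont: "continuous_on {a..b} f"
    by (meson DERIV_isCont continuous_at_imp_continuous_on)
  have g_le: "\<bar>g x\<bar> \<le> M" if "x \<in> {a..b}" for x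
  proof -
    \<comment> \<open>A real supremum bounds its members only when the set is bounded above; here
      continuity on a compact interval supplies this.\<close>
    have "compact ((\<lambda>x. \<bar>g x\<bar>) ` {a..b})"
      by (intro compact_continuous_image continuous_intros assms(8)) auto
    then have "bdd_above ((\<lambda>x. \<bar>g x\<bar>) ` {a..b})"
      by (intro bounded_imp_bdd_above compact_imp_bounded)
    then show ?thesis unfolding M_def sup_norm_on_def using that by (intro cSUP_upper)
  qed
  have conv: "\<bar>deriv f (l * a + (1 - l) * b)\<bar> \<le> l powr s * A + (1 - l) powr s * B"
    if "l \<in> {0..1}" for l
    using assms(12) ab that unfolding s_convex_on_def A_def B_def by auto

  text \<open>Taking \<open>e = d\<close> from \<open>p = a\<close> and \<open>e = -d\<close> from \<open>p = b\<close> covers the two halves of the interval.\<close>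

  have half: "\<bar>f (p + e * (1 / 2)) * integral {0..1 / 2} (\<lambda>u. u powr (\<alpha> - 1) * g (p + e * u))
        - integral {0..1 / 2} (\<lambda>u. u powr (\<alpha> - 1) * (f (p + e * u) * g (p + e * u)))\<bar>
      \<le> M / \<alpha> * (d * X * \<beta> + d * Y * \<gamma>)"
    and half_cont: "continuous_on {0..1 / 2} (\<lambda>u. g (p + e * u))"
      "continuous_on {0..1 / 2} (\<lambda>u. f (p + e * u))"
    if e: "\<bar>e\<bar> = d" and mem: "\<forall>u\<in>{0..1 / 2}. p + e * u \<in> {a..b}"
      and bound: "\<forall>u\<in>{0..1 / 2}.
        \<bar>deriv f (p + e * u)\<bar> \<le> X * (1 - u) powr s + Y * u powr s"
    for p e X Y
  proof -
    show g_cont: "continuous_on {0..1 / 2} (\<lambda>u. g (p + e * u))"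
      by (rule continuous_on_compose2[OF assms(8)]) (use mem in \<open>auto intro!: continuous_intros\<close>)
    show f_cont': "continuous_on {0..1 / 2} (\<lambda>u. f (p + e * u))"
      by (rule continuous_on_compose2[OF f_cont]) (use mem in \<open>auto intro!: continuous_intros\<close>)
    have "\<bar>f (p + e * (1 / 2)) * integral {0..1 / 2} (\<lambda>u. u powr (\<alpha> - 1) * g (p + e * u))
        - integral {0..1 / 2} (\<lambda>u. u powr (\<alpha> - 1) * (f (p + e * u) * g (p + e * u)))\<bar>
      \<le> M / \<alpha> * integral {0..1 / 2}
          (\<lambda>u. u powr \<alpha> * (d * X * (1 - u) powr s + d * Y * u powr s))"
    proof (rule powr_kernel_weighted_bound[OF \<alpha> _ f_cont' _ _ _ g_cont, where F' = "\<lambda>u. e * deriv f (p + e * u)"])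
      fix u :: real assume u: "u \<in> {0<..<1 / 2}"
      show "((\<lambda>u. f (p + e * u)) has_real_derivative e * deriv f (p + e * u)) (at u)"
      proof -
        have "((\<lambda>u. p + e * u) has_real_derivative e) (at u)"
          by (auto intro!: derivative_eq_intros)
        from DERIV_chain2[where f = f and g = "\<lambda>u. p + e * u", OF f'[OF bspec[OF mem]] this] u
        show ?thesis by (simp add: mult.commute[of e "deriv f (p + e * u)"])
      qed
      \<comment> \<open>The chain rule brings in the factor \<open>e\<close>, whose absolute value
        \<open>d\<close> is the extra power of the interval length in the final bound.\<close>
      have "\<bar>e\<bar> * \<bar>deriv f (p + e * u)\<bar> \<le> d * (X * (1 - u) powr s + Y * u powr s)"
        using bspec[OF bound, of u] u d e by (intro mult_mono) auto
      then show "\<bar>e * deriv f (p + e * u)\<bar> \<le> d * X * (1 - u) powr s + d * Y * u powr s"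
        by (simp add: abs_mult algebra_simps)
    next
      show "continuous_on {0..1 / 2} (\<lambda>u. d * X * (1 - u) powr s + d * Y * u powr s)"
        using s by (intro continuous_intros continuous_on_powr') auto
    qed (use g_le mem in auto)
    then show "\<bar>f (p + e * (1 / 2)) * integral {0..1 / 2} (\<lambda>u. u powr (\<alpha> - 1) * g (p + e * u))
        - integral {0..1 / 2} (\<lambda>u. u powr (\<alpha> - 1) * (f (p + e * u) * g (p + e * u)))\<bar>
      \<le> M / \<alpha> * (d * X * \<beta> + d * Y * \<gamma>)"
      using \<alpha> s by (simp add: integral_powr_s_convex_majorant \<beta>_def \<gamma>_def)
  qed

  have du: "0 \<le> d * u \<and> d * u \<le> b - a" if "u \<in> {0..1 / 2}" for u
    using that d mult_left_le[of u d] by (auto simp: d_def)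
  have left_mem: "\<forall>u\<in>{0..1 / 2}. a + d * u \<in> {a..b}"
    using du by (smt (verit) atLeastAtMost_iff mult_minus_left)
  \<comment> \<open>The point at relative distance \<open>u\<close> from \<open>a\<close> is the
    convex combination with weight \<open>1 - u\<close> on \<open>a\<close> and \<open>u\<close> on
    \<open>b\<close>.\<close>
  have left_bound: "\<forall>u\<in>{0..1 / 2}. \<bar>deriv f (a + d * u)\<bar> \<le> A * (1 - u) powr s + B * u powr s"
  proof
    fix u :: real assume u: "u \<in> {0..1 / 2}"
    have "(1 - u) * a + (1 - (1 - u)) * b = a + d * u" by (simp add: d_def algebra_simps)
    then show "\<bar>deriv f (a + d * u)\<bar> \<le> A * (1 - u) powr s + B * u powr s"
      using conv[of "1 - u"] u by (simp add: mult.commute)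
  qed
  have right_mem: "\<forall>u\<in>{0..1 / 2}. b + - d * u \<in> {a..b}"
    using du by (smt (verit) atLeastAtMost_iff mult_minus_left)
  \<comment> \<open>Now \<open>u\<close> measures the distance from \<open>b\<close>, so
    \<open>A\<close> and \<open>B\<close> exchange roles.\<close>
  have right_bound: "\<forall>u\<in>{0..1 / 2}. \<bar>deriv f (b + - d * u)\<bar> \<le> B * (1 - u) powr s + A * u powr s"
  proof
    fix u :: real assume u: "u \<in> {0..1 / 2}"
    have "u * a + (1 - u) * b = b + - d * u" by (simp add: d_def algebra_simps)
    then show "\<bar>deriv f (b + - d * u)\<bar> \<le> B * (1 - u) powr s + A * u powr s"
      using conv[of u] u by (simp add: mult.commute add.commute)
  qed
  have e: "\<bar>d\<bar> = d" "\<bar>- d\<bar> = d" using d by auto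
  note left = half[OF e(1) left_mem left_bound] half_cont[OF e(1) left_mem left_bound]
  note right = half[OF e(2) right_mem right_bound] half_cont[OF e(2) right_mem right_bound]

  define m where "m = (a + b) / 2"
  \<comment> \<open>Both halves end at the midpoint for \<open>u = 1 / 2\<close>, so the same value
    \<open>f m\<close> occurs in each of the two estimates.\<close>
  have m: "a + d * (1 / 2) = m" "b - d * (1 / 2) = m"
    by (simp_all add: d_def m_def field_simps)
  define SL where "SL = f m * integral {0..1 / 2} (\<lambda>u. u powr (\<alpha> - 1) * g (a + d * u))
        - integral {0..1 / 2} (\<lambda>u. u powr (\<alpha> - 1) * (f (a + d * u) * g (a + d * u)))"
  define SR where "SR = f m * integral {0..1 / 2} (\<lambda>u. u powr (\<alpha> - 1) * g (b - d * u))
        - integral {0..1 / 2} (\<lambda>u. u powr (\<alpha> - 1) * (f (b - d * u) * g (b - d * u)))"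
  have SL: "\<bar>SL\<bar> \<le> M / \<alpha> * (d * A * \<beta> + d * B * \<gamma>)"
    using left(1) unfolding SL_def m(1)[symmetric] by simp
  have SR: "\<bar>SR\<bar> \<le> M / \<alpha> * (d * B * \<beta> + d * A * \<gamma>)"
    using right(1) unfolding SR_def m(2)[symmetric] by simp
  have "RL_left \<alpha> m h a = c * integral {0..1 / 2} (\<lambda>u. u powr (\<alpha> - 1) * h (a + d * u))"
    if "continuous_on {0..1 / 2} (\<lambda>u. h (a + d * u))" for h
    using RL_left_eq_integral[OF \<alpha> d _ that] m(1) by (simp add: c_def G_def)
  note RL = this[of g, OF left(2)] this[of "\<lambda>t. f t * g t", OF continuous_on_mult[OF left(3,2)]]
  have "RL_right \<alpha> m h b = c * integral {0..1 / 2} (\<lambda>u. u powr (\<alpha> - 1) * h (b - d * u))"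
    if "continuous_on {0..1 / 2} (\<lambda>u. h (b + - d * u))" for h
    using RL_right_eq_integral[OF \<alpha> d, of "1 / 2" h b] that m(2) by (simp add: c_def G_def)
  note RR = this[of g, OF right(2)] this[of "\<lambda>t. f t * g t", OF continuous_on_mult[OF right(3,2)]]
  have "f m * (RL_left \<alpha> m g a + RL_right \<alpha> m g b)
        - (RL_left \<alpha> m (\<lambda>t. f t * g t) a + RL_right \<alpha> m (\<lambda>t. f t * g t) b) = c * (SL + SR)"
    unfolding RL RR SL_def SR_def by (simp add: algebra_simps)
  then have "\<bar>f m * (RL_left \<alpha> m g a + RL_right \<alpha> m g b)
        - (RL_left \<alpha> m (\<lambda>t. f t * g t) a + RL_right \<alpha> m (\<lambda>t. f t * g t) b)\<bar> = c * \<bar>SL + SR\<bar>"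
    using c by (simp add: abs_mult)
  also have "\<dots> \<le> c * (M / \<alpha> * (d * A * \<beta> + d * B * \<gamma>) + M / \<alpha> * (d * B * \<beta> + d * A * \<gamma>))"
    using SL SR c by (intro mult_left_mono) linarith+
  \<comment> \<open>Across the two halves \<open>A\<close> and \<open>B\<close> each meet \<beta>
    once and \<gamma> once, so the sum factors. The denominator \<alpha> merges with the Gamma value
    in \<open>c\<close> by the functional equation, and \<open>d\<close> raises
    \<open>d powr \<alpha>\<close> by one power.\<close>
  also have "\<dots> = d powr (\<alpha> + 1) * M / Gamma (\<alpha> + 1) * (\<beta> + \<gamma>) * (A + B)"
  proof -
    have "Gamma (\<alpha> + 1) = \<alpha> * G"
      unfolding G_def using \<alpha> by (intro Gamma_plus1) auto
    then show ?thesis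
      using \<alpha> d G by (simp add: c_def powr_add field_simps)
  qed
  also have "\<gamma> = 1 / (2 powr (\<alpha> + s + 1) * (\<alpha> + s + 1))"
    by (simp add: \<gamma>_def powr_divide)
  finally show ?thesis
    by (simp only: m_def d_def M_def A_def B_def \<beta>_def)
qed

end
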